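(* Fix $\alpha\in(0,1)$. Let $\{U_{jk}\}$ be rank-type $U$-statistics of degree $m$ with kernel $h$, and suppose that $h$ is bounded with $|h(\cdot)|\le A_3$ and $$m^2\,\mathrm{var}_{H_0}\big[E_{H_0}\{h(X_{1,\{1,2\}},\ldots,X_{m,\{1,2\}})\mid X_{1,\{1,2\}}\}\big]=\{1+o(1)\}A_4$$ for some positive constants $A_3$ and $A_4$. Then for some large scalar $B_2$ depending only on $A_3,A_4$, and $m$, $$\inf_{F(X)\in H_a^U(B_2)}\mathrm{pr}(\widetilde T_\alpha=1)=1-o(1),$$ where the infimum is taken over all distributions $F(X)$ such that $U\{F(X)\}\in\mathcal U(B_2)$.
   Context: Setting: $X=(X_1,\ldots,X_d)^{\mathrm T}$ is a continuous random vector in $\mathbb{R}^d$ with joint distribution function $F(X)$, and $X_{1,\cdot},\ldots,X_{n,\cdot}$ are $n$ independent copies of $X$. The dimension $d=d_n$ may depend on $n$; both $n$ and $d$ tend to infinity. $H_0$: $X_1,\ldots,X_d$ are mutually independent. Relative ranks: $Q_{ni}^j$ is the rank of $X_{i,j}$ in $\{X_{1,j},\ldots,X_{n,j}\}$, and $R_{ni}^{jk}=Q_{ni'}^k$ where $i'$ is the index with $Q_{ni'}^j=i$. Rank-type $U$-statistics: $$U_{jk}=\frac{1}{n(n-1)\cdots(n-m+1)}\sum_{i_1\neq\cdots\neq i_m}h(X_{i_1,\{j,k\}},\ldots,X_{i_m,\{j,k\}}),$$ the sum being over pairwise distinct indices, $X_{i,\{j,k\}}=(X_{i,j},X_{i,k})$,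 $m<n$, $h$ bounded but not necessarily symmetric, with $U_{jk}$ depending on the data only through $\{R_{ni}^{jk}\}_{i=1}^n$. Under $H_0$ the distribution of $U_{jk}$ is free of the distribution of $X$ and of $(j,k)$; $E_{H_0},\mathrm{var}_{H_0}$ denote expectation and variance under $H_0$. Let $\sigma_U^2=n\,\mathrm{var}_{H_0}(U_{jk})$ and $\widetilde L_n=\max_{j<k}|U_{jk}-E_{H_0}(U_{jk})|$. The test is $$\widetilde T_\alpha=I\Big(\frac{n\widetilde L_n^2}{\sigma_U^2}-4\log d+\log\log d\ge q_\alpha\Big),\qquad q_\alpha=-\log(8\pi)-2\log\log(1-\alpha)^{-1}.$$ Alternative: for a constant $c$, $$\mathcal U(c)=\Big\{M\in\mathbb{R}^{d\times d}:\mathrm{diag}(M)=I_d,\ M=M^{\mathrm T},\ \max_{1\le j<k\le d}|M_{jk}|\ge c(\log d/n)^{1/2}\Big\}.$$ With $\widetilde\sigma_U^2=m^2\mathrm{var}_{H_0}[E_{H_0}\{h(X_{1,\{1,2\}},\ldots,X_{m,\{1,2\}})\mid X_{1,\{1,2\}}\}]$, the random matrix $\widehat U\in\mathbb{R}^{d\times d}$ has entries $\widehat U_{jk}=\widehat U_{kj}=\widetilde\sigma_U^{-1}\{U_{jk}-E_{H_0}(U_{jk})\}$ for $j<k$ and $\widehat U_{\ell\ell}=1$; $U=U\{F(X)\}=E(\widehat U)$, expectation under $F(X)$; and $H_a^U(c)=\{F(X):U\{F(X)\}\in\mathcal U(c)\}$. *)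

theory Defs
  imports "HOL-Probability.Probability" "HOL-Library.Landau_Symbols"
begin

text \<open>
  Coordinates are indexed by \<open>{..<d}\<close> and observations by \<open>{..<n}\<close>. A law on \<open>\<real>\<^sup>d\<close> is a measure on
  \<open>Pi\<^sub>M {..<d} (\<lambda>_. borel)\<close>; a data set \<open>x\<close> has entries \<open>x i j\<close> (observation \<open>i\<close>, coordinate \<open>j\<close>).
\<close>

definition continuous_laws :: "nat \<Rightarrow> (nat \<Rightarrow> real) measure set" where
  "continuous_laws d = {F. prob_space F \<and> sets F = sets (Pi\<^sub>M {..<d} (\<lambda>_. borel)) \<and>
     continuous_on UNIV (\<lambda>t :: nat \<Rightarrow> real. measure F {x \<in> space F. \<forall>j<d. x j \<le> t j})}"

definition null_laws :: "nat \<Rightarrow> (nat \<Rightarrow> real) measure set" where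
  "null_laws d = {F \<in> continuous_laws d.
     prob_space.indep_vars F (\<lambda>_. borel) (\<lambda>j x. x j) {..<d}}"

definition sample_law :: "nat \<Rightarrow> (nat \<Rightarrow> real) measure \<Rightarrow> (nat \<Rightarrow> nat \<Rightarrow> real) measure" where
  "sample_law n F = Pi\<^sub>M {..<n} (\<lambda>_. F)"

definition mean_under :: "'a measure \<Rightarrow> ('a \<Rightarrow> real) \<Rightarrow> real" where
  "mean_under M f = (LINT x|M. f x)"

definition var_under :: "'a measure \<Rightarrow> ('a \<Rightarrow> real) \<Rightarrow> real" where
  "var_under M f = (LINT x|M. (f x - mean_under M f)\<^sup>2)"

definition pair_data :: "nat \<Rightarrow> nat \<Rightarrow> (nat \<Rightarrow> nat \<Rightarrow> real) \<Rightarrow> nat \<Rightarrow> real \<times> real" where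
  "pair_data j k x = (\<lambda>i. (x i j, x i k))"


definition rank_in :: "nat \<Rightarrow> (nat \<Rightarrow> real) \<Rightarrow> nat \<Rightarrow> nat" where
  "rank_in n y i = card {i' \<in> {..<n}. y i' \<le> y i}"

text \<open>Ranks take the values \<open>1, \<dots>, n\<close>, so relative ranks are indexed by \<open>{1..n}\<close>.\<close>

definition relative_rank :: "nat \<Rightarrow> (nat \<Rightarrow> real \<times> real) \<Rightarrow> nat \<Rightarrow> nat" where
  "relative_rank n z i =
     rank_in n (\<lambda>l. snd (z l)) (THE i'. i' < n \<and> rank_in n (\<lambda>l. fst (z l)) i' = i)"

definition no_ties :: "nat \<Rightarrow> (nat \<Rightarrow> real \<times> real) \<Rightarrow> bool" where
  "no_ties n z \<longleftrightarrow> inj_on (\<lambda>i. fst (z i)) {..<n} \<and> inj_on (\<lambda>i. snd (z i)) {..<n}"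


text \<open>
  A kernel of degree \<open>m\<close> is a function of tuples \<open>{..<m} \<rightarrow>\<^sub>E UNIV\<close>; tuples of pairwise distinct
  observation indices are injections of \<open>{..<m}\<close> into \<open>{..<n}\<close>.
\<close>

definition U_statistic ::
    "nat \<Rightarrow> nat \<Rightarrow> ((nat \<Rightarrow> real \<times> real) \<Rightarrow> real) \<Rightarrow> (nat \<Rightarrow> real \<times> real) \<Rightarrow> real" where
  "U_statistic n m h z =
     (\<Sum>\<iota> \<in> {\<iota> \<in> {..<m} \<rightarrow>\<^sub>E {..<n}. inj_on \<iota> {..<m}}. h (\<lambda>l\<in>{..<m}. z (\<iota> l)))
       / (\<Prod>l<m. real n - real l)"

text \<open>
  Dependence on the relative ranks only is required for data without ties; under a continuous law
  ties have probability zero.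
\<close>

definition rank_type_kernel :: "nat \<Rightarrow> nat \<Rightarrow> ((nat \<Rightarrow> real \<times> real) \<Rightarrow> real) \<Rightarrow> bool" where
  "rank_type_kernel n m h \<longleftrightarrow>
     h \<in> borel_measurable (Pi\<^sub>M {..<m} (\<lambda>_. borel)) \<and>
     (\<forall>z z'. no_ties n z \<longrightarrow> no_ties n z' \<longrightarrow>
        (\<forall>i\<in>{1..n}. relative_rank n z i = relative_rank n z' i) \<longrightarrow>
        U_statistic n m h z = U_statistic n m h z')"

text \<open>
  Below, \<open>P0\<close> is an arbitrary law satisfying the null hypothesis, used to evaluate null moments.
  The null distribution of a rank-type U-statistic depends neither on which such law is taken nor
  on the pair of coordinates, so \<open>sigma2_U\<close> may be computed from coordinates \<open>0\<close> and \<open>1\<close>. A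
  non-symmetric kernel need not itself be a function of ranks, so \<open>sigma2_tilde_U\<close> may depend
  on \<open>P0\<close>; nothing is assumed about this dependence.
\<close>

definition sigma2_U ::
    "nat \<Rightarrow> nat \<Rightarrow> ((nat \<Rightarrow> real \<times> real) \<Rightarrow> real) \<Rightarrow> (nat \<Rightarrow> real) measure \<Rightarrow> real" where
  "sigma2_U n m h P0 =
     real n * var_under (sample_law n P0) (\<lambda>x. U_statistic n m h (pair_data 0 1 x))"

definition sigma2_tilde_U ::
    "nat \<Rightarrow> nat \<Rightarrow> ((nat \<Rightarrow> real \<times> real) \<Rightarrow> real) \<Rightarrow> (nat \<Rightarrow> real) measure \<Rightarrow> real" where
  "sigma2_tilde_U n m h P0 =
     (let S = sample_law n P0 in
      (real m)\<^sup>2 * var_under S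
        (real_cond_exp S (vimage_algebra (space S) (\<lambda>x. pair_data 0 1 x 0) borel)
           (\<lambda>x. h (\<lambda>i\<in>{..<m}. pair_data 0 1 x i))))"

definition centred_U ::
    "nat \<Rightarrow> nat \<Rightarrow> ((nat \<Rightarrow> real \<times> real) \<Rightarrow> real) \<Rightarrow> (nat \<Rightarrow> real) measure
       \<Rightarrow> nat \<Rightarrow> nat \<Rightarrow> (nat \<Rightarrow> nat \<Rightarrow> real) \<Rightarrow> real" where
  "centred_U n m h P0 j k x =
     U_statistic n m h (pair_data j k x)
       - mean_under (sample_law n P0) (\<lambda>x'. U_statistic n m h (pair_data j k x'))"


definition max_U ::
    "nat \<Rightarrow> nat \<Rightarrow> nat \<Rightarrow> ((nat \<Rightarrow> real \<times> real) \<Rightarrow> real) \<Rightarrow> (nat \<Rightarrow> real) measure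
       \<Rightarrow> (nat \<Rightarrow> nat \<Rightarrow> real) \<Rightarrow> real" where
  "max_U n d m h P0 x = Max {\<bar>centred_U n m h P0 j k x\<bar> | j k. j < k \<and> k < d}"

definition gumbel_quantile :: "real \<Rightarrow> real" where
  "gumbel_quantile \<alpha> = - ln (8 * pi) - 2 * ln (ln (inverse (1 - \<alpha>)))"

definition U_test ::
    "real \<Rightarrow> nat \<Rightarrow> nat \<Rightarrow> nat \<Rightarrow> ((nat \<Rightarrow> real \<times> real) \<Rightarrow> real) \<Rightarrow> (nat \<Rightarrow> real) measure
       \<Rightarrow> (nat \<Rightarrow> nat \<Rightarrow> real) \<Rightarrow> nat" where
  "U_test \<alpha> n d m h P0 x =
     of_bool (real n * (max_U n d m h P0 x)\<^sup>2 / sigma2_U n m h P0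
                - 4 * ln (real d) + ln (ln (real d)) \<ge> gumbel_quantile \<alpha>)"


text \<open>\<open>d \<times> d\<close> matrices are functions of two indices, of which only the values below \<open>d\<close> matter.\<close>

definition alternative_matrices :: "nat \<Rightarrow> nat \<Rightarrow> real \<Rightarrow> (nat \<Rightarrow> nat \<Rightarrow> real) set" where
  "alternative_matrices n d c =
     {M. (\<forall>j<d. M j j = 1) \<and> (\<forall>j<d. \<forall>k<d. M j k = M k j) \<and>
         Max {\<bar>M j k\<bar> | j k. j < k \<and> k < d} \<ge> c * sqrt (ln (real d) / real n)}"

definition U_hat ::
    "nat \<Rightarrow> nat \<Rightarrow> ((nat \<Rightarrow> real \<times> real) \<Rightarrow> real) \<Rightarrow> (nat \<Rightarrow> real) measure
       \<Rightarrow> (nat \<Rightarrow> nat \<Rightarrow> real) \<Rightarrow> nat \<Rightarrow> nat \<Rightarrow> real" where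
  "U_hat n m h P0 x j k =
     (if j = k then 1
      else centred_U n m h P0 (min j k) (max j k) x / sqrt (sigma2_tilde_U n m h P0))"

definition U_mean ::
    "nat \<Rightarrow> nat \<Rightarrow> ((nat \<Rightarrow> real \<times> real) \<Rightarrow> real) \<Rightarrow> (nat \<Rightarrow> real) measure
       \<Rightarrow> (nat \<Rightarrow> real) measure \<Rightarrow> nat \<Rightarrow> nat \<Rightarrow> real" where
  "U_mean n m h P0 F j k = mean_under (sample_law n F) (\<lambda>x. U_hat n m h P0 x j k)"

definition U_alternatives ::
    "nat \<Rightarrow> nat \<Rightarrow> nat \<Rightarrow> ((nat \<Rightarrow> real \<times> real) \<Rightarrow> real) \<Rightarrow> (nat \<Rightarrow> real) measure
       \<Rightarrow> real \<Rightarrow> (nat \<Rightarrow> real) measure set" where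
  "U_alternatives n d m h P0 c =
     {F \<in> continuous_laws d. U_mean n m h P0 F \<in> alternative_matrices n d c}"

text \<open>
  The infimum is taken in the unit interval: the added element \<open>1\<close> only matters when there is no
  alternative at all, in which case it makes the infimum \<open>1\<close> rather than an unspecified real.
\<close>

definition min_power ::
    "real \<Rightarrow> nat \<Rightarrow> nat \<Rightarrow> nat \<Rightarrow> ((nat \<Rightarrow> real \<times> real) \<Rightarrow> real) \<Rightarrow> (nat \<Rightarrow> real) measure
       \<Rightarrow> real \<Rightarrow> real" where
  "min_power \<alpha> n d m h P0 c =
     Inf (insert 1 ((\<lambda>F. measure (sample_law n F)
                          {x \<in> space (sample_law n F). U_test \<alpha> n d m h P0 x = 1})
                     ` U_alternatives n d m h P0 c))"

end

theory Submission
  imports Defs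
begin

text \<open>
  The test rejects as soon as one of the statistics \<open>U j k\<close> is far from its null mean. At an
  alternative, some pair has its expectation shifted by at least a large multiple of
  \<open>\<surd>(ln d / n)\<close>. The fluctuation of a single bounded U-statistic is only of order \<open>1 / \<surd>n\<close>, under any law:
  its variance is at most \<open>4 A3\<^sup>2 m\<^sup>2 / n\<close>, because summands over disjoint index tuples are uncorrelated
  and only a fraction of at most \<open>m\<^sup>2 / n\<close> of the pairs of tuples overlap (\<open>variance_U_le\<close>). Applied to the one
  shifted pair, Chebyshev's inequality gives power at least \<open>1 - 1 / (5 ln d)\<close>, uniformly over the alternatives
  (\<open>U_test_power_at_alternative\<close>). The same variance bound controls the normalisation \<open>sigma2_U\<close> from above,
  also when a non-symmetric kernel keeps it away from \<open>sigma2_tilde_U\<close>.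

  What remains is that \<open>sigma2_U\<close> may vanish, in which case the normalised statistic is \<open>0\<close> by the
  convention for division and the test never rejects for large \<open>d\<close>. Here the rank property matters. Under the
  null hypothesis every rank pattern has positive probability (\<open>exists_sample_with_ranks\<close>), so a
  statistic with zero null variance takes one and the same value on all data without ties
  (\<open>U_constant_of_null_variance\<close>). Continuous laws produce ties with probability zero, so then all means
  coincide and there is no alternative.
\<close>

section \<open>Overlapping index tuples\<close>

definition index_tuples :: "nat \<Rightarrow> nat \<Rightarrow> (nat \<Rightarrow> nat) set" where
  "index_tuples n m = {\<iota> \<in> {..<m} \<rightarrow>\<^sub>E {..<n}. inj_on \<iota> {..<m}}"

lemma finite_index_tuples [simp]: "finite (index_tuples n m)"
  unfolding index_tuples_def by (rule finite_subset[OF _ finite_PiE[of "{..<m}" "\<lambda>_. {..<n}"]]) auto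

lemma index_tuplesD: "\<iota> \<in> index_tuples n m \<Longrightarrow> l < m \<Longrightarrow> \<iota> l < n"
  unfolding index_tuples_def by auto

lemma card_index_tuples:
  assumes "m \<le> n"
  shows "real (card (index_tuples n m)) = (\<Prod>l<m. real n - real l)"
proof -
  have "card (index_tuples n m) = (\<Prod>l<m. n - l)"
    using card_inj_on_subset_funcset[of "{..<m}" "{..<n}" "{..<m}"]
    by (simp add: index_tuples_def atLeast0LessThan)
  then show ?thesis
    using assms by (simp add: of_nat_diff)
qed

lemma card_index_tuples_pos:
  assumes "m \<le> n"
  shows "real (card (index_tuples n m)) > 0"
  unfolding card_index_tuples[OF assms] using assms by (intro prod_pos) auto

text \<open>
  Transposing two observation indices maps the tuples with \<open>\<iota> l = b\<close> injectively into those with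
  \<open>\<iota> l = c\<close>. Hence the value at position \<open>l\<close> is equidistributed: every observation index occurs there
  in the fraction \<open>1 / n\<close> of all tuples.
\<close>

lemma card_index_tuples_through:
  assumes "l < m" "a < n"
  shows "n * card {\<iota> \<in> index_tuples n m. \<iota> l = a} = card (index_tuples n m)"
proof -
  let ?S = "\<lambda>b. {\<iota> \<in> index_tuples n m. \<iota> l = b}"
  have le: "card (?S b) \<le> card (?S c)" if "b < n" "c < n" for b c
  proof -
    define t where "t = (\<lambda>x. if x = b then c else if x = c then b else x)"
    have t_invol: "t (t x) = x" for x by (auto simp: t_def)
    have t_inj: "inj_on t A" for A by (metis inj_onI t_invol)
    have t_lt: "t x < n" if "x < n" for x using that \<open>b < n\<close> \<open>c < n\<close> by (auto simp: t_def)
    let ?f = "\<lambda>\<iota>. \<lambda>i\<in>{..<m}. t (\<iota> i)"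
    show ?thesis
    proof (rule card_inj_on_le[of ?f])
      show "inj_on ?f (?S b)"
      proof (rule inj_onI)
        fix \<iota> \<kappa> assume *: "\<iota> \<in> ?S b" "\<kappa> \<in> ?S b" "?f \<iota> = ?f \<kappa>"
        have "\<iota> i = \<kappa> i" if "i < m" for i
          using fun_cong[OF *(3), of i] that t_invol by (simp) (metis t_invol)
        with * show "\<iota> = \<kappa>"
          unfolding index_tuples_def by (intro PiE_ext[of \<iota> "{..<m}" "\<lambda>_. {..<n}"]) auto
      qed
      show "?f ` ?S b \<subseteq> ?S c"
      proof (rule image_subsetI)
        fix \<iota> assume *: "\<iota> \<in> ?S b"
        have "inj_on (t \<circ> \<iota>) {..<m}"
          using * by (intro comp_inj_on t_inj) (auto simp: index_tuples_def)
        then have "inj_on (?f \<iota>) {..<m}"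
          by (rule inj_on_cong[THEN iffD1, rotated]) auto
        moreover have "?f \<iota> l = c" using * assms by (auto simp: t_def)
        moreover have "?f \<iota> \<in> {..<m} \<rightarrow>\<^sub>E {..<n}" using * t_lt by (auto dest: index_tuplesD)
        ultimately show "?f \<iota> \<in> ?S c" by (auto simp: index_tuples_def)
      qed
    qed simp
  qed
  have "index_tuples n m = (\<Union>b<n. ?S b)"
    using assms by (auto dest: index_tuplesD)
  then have "card (index_tuples n m) = card (\<Union>b<n. ?S b)" by simp
  also have "\<dots> = (\<Sum>b<n. card (?S b))"
    by (rule card_UN_disjoint) auto
  also have "\<dots> = (\<Sum>b<n. card (?S a))"
    using le assms by (intro sum.cong refl antisym) auto
  finally show ?thesis by simp
qed

definition overlapping :: "nat \<Rightarrow> nat \<Rightarrow> (nat \<Rightarrow> nat) \<Rightarrow> (nat \<Rightarrow> nat) set" where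
  "overlapping n m \<iota> = {\<kappa> \<in> index_tuples n m. \<iota> ` {..<m} \<inter> \<kappa> ` {..<m} \<noteq> {}}"

text \<open>
  Two tuples that meet agree in one of the \<open>m\<^sup>2\<close> pairs of positions, and each such agreement has
  frequency \<open>1 / n\<close>. This union bound is the source of the rate \<open>1 / n\<close> in the variance bound below.
\<close>

lemma card_overlapping:
  assumes "\<iota> \<in> index_tuples n m"
  shows "real n * real (card (overlapping n m \<iota>)) \<le> (real m)\<^sup>2 * real (card (index_tuples n m))"
proof -
  let ?S = "\<lambda>p. {\<kappa> \<in> index_tuples n m. \<kappa> (snd p) = \<iota> (fst p)}"
  have "overlapping n m \<iota> \<subseteq> (\<Union>p\<in>{..<m} \<times> {..<m}. ?S p)"
    by (auto simp: overlapping_def)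
  then have "card (overlapping n m \<iota>) \<le> card (\<Union>p\<in>{..<m} \<times> {..<m}. ?S p)"
    by (intro card_mono finite_UN_I) auto
  also have "\<dots> \<le> (\<Sum>p\<in>{..<m} \<times> {..<m}. card (?S p))"
    by (rule card_UN_le) auto
  finally have "n * card (overlapping n m \<iota>) \<le> (\<Sum>p\<in>{..<m} \<times> {..<m}. n * card (?S p))"
    unfolding sum_distrib_left[symmetric] by (rule mult_le_mono2)
  also have "\<dots> = (\<Sum>p\<in>{..<m} \<times> {..<m}. card (index_tuples n m))"
    using assms by (intro sum.cong refl card_index_tuples_through) (auto dest: index_tuplesD)
  also have "\<dots> = m\<^sup>2 * card (index_tuples n m)"
    by (simp add: power2_eq_square)
  finally have "real (n * card (overlapping n m \<iota>)) \<le> real (m\<^sup>2 * card (index_tuples n m))"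
    by (rule of_nat_mono)
  then show ?thesis by simp
qed

section \<open>Variance of a bounded U-statistic\<close>

lemma continuous_lawD:
  assumes "F \<in> continuous_laws d"
  shows "prob_space F" "sets F = sets (Pi\<^sub>M {..<d} (\<lambda>_. borel))"
  using assms by (auto simp: continuous_laws_def)

lemma coordinate_measurable:
  assumes "sets F = sets (Pi\<^sub>M {..<d} (\<lambda>_. borel))" "j < d"
  shows "(\<lambda>y. y j) \<in> borel_measurable F"
  using assms measurable_cong_sets[OF assms(1) refl, of borel] by simp

lemma prob_space_sample_law: "prob_space F \<Longrightarrow> prob_space (sample_law n F)"
  unfolding sample_law_def by (rule prob_space_PiM)

lemma indep_observations:
  assumes "prob_space F" "n > 0"
  shows "prob_space.indep_vars (sample_law n F) (\<lambda>_. F) (\<lambda>i x. x i) {..<n}"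
proof -
  interpret S: prob_space "sample_law n F" by (rule prob_space_sample_law[OF assms(1)])
  have "distr (sample_law n F) (Pi\<^sub>M {..<n} (\<lambda>_. F)) (\<lambda>x. \<lambda>i\<in>{..<n}. x i) =
      distr (sample_law n F) (Pi\<^sub>M {..<n} (\<lambda>_. F)) (\<lambda>x. x)"
    by (rule distr_cong) (auto simp: sample_law_def space_PiM extensional_restrict PiE_def)
  also have "\<dots> = Pi\<^sub>M {..<n} (\<lambda>i. F)"
    unfolding sample_law_def by simp
  also have "\<dots> = Pi\<^sub>M {..<n} (\<lambda>i. distr (sample_law n F) F (\<lambda>x. x i))"
    unfolding sample_law_def by (intro PiM_cong refl distr_PiM_component[symmetric]) (auto simp: assms)
  finally show ?thesis
    using \<open>n > 0\<close> by (subst S.indep_vars_iff_distr_eq_PiM') (auto simp: sample_law_def)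
qed

definition summand ::
    "nat \<Rightarrow> ((nat \<Rightarrow> real \<times> real) \<Rightarrow> real) \<Rightarrow> nat \<Rightarrow> nat \<Rightarrow> (nat \<Rightarrow> nat) \<Rightarrow> (nat \<Rightarrow> nat \<Rightarrow> real) \<Rightarrow> real" where
  "summand m h j k \<iota> x = h (\<lambda>l\<in>{..<m}. pair_data j k x (\<iota> l))"

lemma U_statistic_eq_average:
  assumes "m \<le> n"
  shows "U_statistic n m h (pair_data j k x) =
    (\<Sum>\<iota>\<in>index_tuples n m. summand m h j k \<iota> x) / real (card (index_tuples n m))"
  using card_index_tuples[OF assms] by (simp add: U_statistic_def summand_def index_tuples_def)

text \<open>
  The setting for one pair of coordinates \<open>j, k\<close> of a sample from \<open>F\<close>. The moment
  bounds derived here are applied both to alternative laws and to the null law, where they bound \<open>sigma2_U\<close>.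
\<close>

locale bounded_pair_kernel = F: prob_space F
  for F :: "(nat \<Rightarrow> real) measure" +
  fixes n m d :: nat and h :: "(nat \<Rightarrow> real \<times> real) \<Rightarrow> real" and A :: real and j k :: nat
  assumes sets_F: "sets F = sets (Pi\<^sub>M {..<d} (\<lambda>_. borel))"
    and h_meas: "h \<in> borel_measurable (Pi\<^sub>M {..<m} (\<lambda>_. borel))"
    and h_bound: "z \<in> {..<m} \<rightarrow>\<^sub>E UNIV \<Longrightarrow> \<bar>h z\<bar> \<le> A"
    and j: "j < d" and k: "k < d" and mn: "m < n"
begin

sublocale S: prob_space "sample_law n F"
  by (rule prob_space_sample_law[OF F.prob_space_axioms])

lemma summand_bound: "\<bar>summand m h j k \<iota> x\<bar> \<le> A"
  unfolding summand_def by (rule h_bound) auto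

text \<open>
  A summand as a function of only those observations whose index lies in the block \<open>I\<close>; disjoint
  blocks are independent, which is how the summands become uncorrelated.
\<close>

lemma kernel_measurable_on_block:
  assumes "\<iota> \<in> index_tuples n m" "\<iota> ` {..<m} \<subseteq> I"
  shows "(\<lambda>w. h (\<lambda>l\<in>{..<m}. (w (\<iota> l) j, w (\<iota> l) k))) \<in> borel_measurable (Pi\<^sub>M I (\<lambda>_. F))"
proof (rule measurable_compose[OF _ h_meas], rule measurable_restrict)
  fix l assume l: "l \<in> {..<m}"
  then have "\<iota> l \<in> I" using assms by auto
  then have "(\<lambda>w. w (\<iota> l)) \<in> measurable (Pi\<^sub>M I (\<lambda>_. F)) F" by simp
  note * = measurable_compose[OF this]
  show "(\<lambda>w. (w (\<iota> l) j, w (\<iota> l) k)) \<in> borel_measurable (Pi\<^sub>M I (\<lambda>_. F))"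
    using *[OF coordinate_measurable[OF sets_F j]] *[OF coordinate_measurable[OF sets_F k]]
    by (intro borel_measurable_Pair)
qed

lemma summand_measurable:
  assumes "\<iota> \<in> index_tuples n m"
  shows "summand m h j k \<iota> \<in> borel_measurable (sample_law n F)"
  using kernel_measurable_on_block[OF assms, of "{..<n}"] index_tuplesD[OF assms]
  by (auto simp: summand_def[abs_def] pair_data_def sample_law_def)

lemma summand_integrable:
  assumes "\<iota> \<in> index_tuples n m"
  shows "integrable (sample_law n F) (summand m h j k \<iota>)"
  using summand_bound by (intro S.integrable_const_bound[of _ A] summand_measurable assms) auto

lemma summands_uncorrelated:
  assumes \<iota>: "\<iota> \<in> index_tuples n m" and \<kappa>: "\<kappa> \<in> index_tuples n m"
    and disjoint: "\<iota> ` {..<m} \<inter> \<kappa> ` {..<m} = {}"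
  shows "S.expectation (\<lambda>x. summand m h j k \<iota> x * summand m h j k \<kappa> x) =
    S.expectation (summand m h j k \<iota>) * S.expectation (summand m h j k \<kappa>)"
proof (rule S.indep_var_lebesgue_integral[OF _ summand_integrable summand_integrable])
  let ?I = "\<iota> ` {..<m}" and ?K = "\<kappa> ` {..<m}"
  let ?g = "\<lambda>\<iota> w. h (\<lambda>l\<in>{..<m}. (w (\<iota> l) j, w (\<iota> l) k))"
  have "S.indep_var (Pi\<^sub>M ?I (\<lambda>_. F)) (\<lambda>x. restrict (\<lambda>i. x i) ?I) (Pi\<^sub>M ?K (\<lambda>_. F)) (\<lambda>x. restrict (\<lambda>i. x i) ?K)"
    using \<iota> \<kappa> disjoint mn
    by (intro S.indep_var_restrict[OF indep_observations[OF F.prob_space_axioms]]) (auto dest: index_tuplesD)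
  then have "S.indep_var borel (?g \<iota> \<circ> (\<lambda>x. restrict (\<lambda>i. x i) ?I)) borel (?g \<kappa> \<circ> (\<lambda>x. restrict (\<lambda>i. x i) ?K))"
    by (rule S.indep_var_compose) (intro kernel_measurable_on_block \<iota> \<kappa> subset_refl)+
  moreover have "?g \<nu> \<circ> (\<lambda>x. restrict (\<lambda>i. x i) (\<nu> ` {..<m})) = summand m h j k \<nu>" for \<nu>
    by (auto simp: fun_eq_iff summand_def pair_data_def intro!: arg_cong[of _ _ h])
  ultimately show "S.indep_var borel (summand m h j k \<iota>) borel (summand m h j k \<kappa>)"
    by simp
qed fact+

lemma U_measurable:
  "(\<lambda>x. U_statistic n m h (pair_data j k x)) \<in> borel_measurable (sample_law n F)"
  using summand_measurable mn by (simp add: U_statistic_eq_average)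

lemma U_bound: "\<bar>U_statistic n m h (pair_data j k x)\<bar> \<le> A"
proof -
  have "\<bar>\<Sum>\<iota>\<in>index_tuples n m. summand m h j k \<iota> x\<bar> \<le> (\<Sum>\<iota>\<in>index_tuples n m. A)"
    by (rule order_trans[OF sum_abs]) (intro sum_mono summand_bound)
  then show ?thesis
    using mn card_index_tuples_pos[of m n]
    by (simp add: U_statistic_eq_average abs_mult divide_le_eq mult.commute)
qed

lemma U_integrable: "integrable (sample_law n F) (\<lambda>x. U_statistic n m h (pair_data j k x))"
  using U_bound by (intro S.integrable_const_bound[of _ A] U_measurable) auto

lemma U_centred_integrable_sq:
  "integrable (sample_law n F) (\<lambda>x. (U_statistic n m h (pair_data j k x) - c)\<^sup>2)"
proof (rule S.integrable_const_bound[of _ "(A + \<bar>c\<bar>)\<^sup>2"])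
  show "AE x in sample_law n F. norm ((U_statistic n m h (pair_data j k x) - c)\<^sup>2) \<le> (A + \<bar>c\<bar>)\<^sup>2"
  proof (rule AE_I2)
    fix x
    have "\<bar>U_statistic n m h (pair_data j k x) - c\<bar> \<le> A + \<bar>c\<bar>" using U_bound[of x] by linarith
    then have "\<bar>U_statistic n m h (pair_data j k x) - c\<bar>\<^sup>2 \<le> (A + \<bar>c\<bar>)\<^sup>2" by (rule power_mono) simp
    then show "norm ((U_statistic n m h (pair_data j k x) - c)\<^sup>2) \<le> (A + \<bar>c\<bar>)\<^sup>2" by simp
  qed
qed (use U_measurable in measurable)

text \<open>
  The variance is the average, over pairs of tuples, of the covariances of their summands. Pairs
  without a common observation contribute \<open>0\<close>, the others at most \<open>4 A\<^sup>2\<close> each, and by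
  \<open>card_overlapping\<close> the others form a fraction of at most \<open>m\<^sup>2 / n\<close>.
\<close>

lemma variance_U_le:
  "var_under (sample_law n F) (\<lambda>x. U_statistic n m h (pair_data j k x)) \<le> 4 * A\<^sup>2 * (real m)\<^sup>2 / real n"
proof -
  let ?T = "index_tuples n m" and ?E = "S.expectation"
  define N where "N = real (card ?T)"
  have N: "N > 0" using card_index_tuples_pos[of m n] mn by (simp add: N_def)
  have A: "A \<ge> 0" using summand_bound[of undefined undefined] by linarith
  define g where "g \<iota> x = summand m h j k \<iota> x - ?E (summand m h j k \<iota>)" for \<iota> x
  have E_bound: "\<bar>?E (summand m h j k \<iota>)\<bar> \<le> A" if "\<iota> \<in> ?T" for \<iota>
  proof -
    have "\<bar>?E (summand m h j k \<iota>)\<bar> \<le> ?E (\<lambda>x. \<bar>summand m h j k \<iota> x\<bar>)" by (rule integral_abs_bound)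
    also have "\<dots> \<le> ?E (\<lambda>x. A)"
      using summand_bound summand_integrable[OF that] by (intro integral_mono) auto
    finally show ?thesis by (simp add: S.prob_space)
  qed
  have g_bound: "\<bar>g \<iota> x\<bar> \<le> 2 * A" if "\<iota> \<in> ?T" for \<iota> x
    using summand_bound[of \<iota> x] E_bound[OF that] by (simp add: g_def)
  have gg_bound: "\<bar>g \<iota> x * g \<kappa> x\<bar> \<le> 4 * A\<^sup>2" if "\<iota> \<in> ?T" "\<kappa> \<in> ?T" for \<iota> \<kappa> x
    using mult_mono[OF g_bound[OF that(1), of x] g_bound[OF that(2), of x]] A
    by (simp add: abs_mult power2_eq_square)
  have g_meas [measurable]: "g \<iota> \<in> borel_measurable (sample_law n F)" if "\<iota> \<in> ?T" for \<iota>
    using summand_measurable[OF that] by (simp add: g_def[abs_def])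
  have gg_int: "integrable (sample_law n F) (\<lambda>x. g \<iota> x * g \<kappa> x)" if "\<iota> \<in> ?T" "\<kappa> \<in> ?T" for \<iota> \<kappa>
    using gg_bound[OF that] g_meas[OF that(1)] g_meas[OF that(2)]
    by (intro S.integrable_const_bound[of _ "4 * A\<^sup>2"]) auto
  have cov_le: "?E (\<lambda>x. g \<iota> x * g \<kappa> x) \<le> 4 * A\<^sup>2 * of_bool (\<kappa> \<in> overlapping n m \<iota>)"
    if T: "\<iota> \<in> ?T" "\<kappa> \<in> ?T" for \<iota> \<kappa>
  proof (cases "\<kappa> \<in> overlapping n m \<iota>")
    case True
    have "?E (\<lambda>x. g \<iota> x * g \<kappa> x) \<le> ?E (\<lambda>x. 4 * A\<^sup>2)"
      using gg_bound[OF T] by (intro integral_mono gg_int T) (auto simp: abs_le_iff)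
    with True show ?thesis by (simp add: S.prob_space)
  next
    case False
    let ?u = "summand m h j k \<iota>" and ?v = "summand m h j k \<kappa>"
    have uv_int: "integrable (sample_law n F) (\<lambda>x. ?u x * ?v x)"
    proof (rule S.integrable_const_bound[of _ "A * A"])
      show "AE x in sample_law n F. norm (?u x * ?v x) \<le> A * A"
        using summand_bound A by (auto simp: abs_mult intro!: mult_mono)
      show "(\<lambda>x. ?u x * ?v x) \<in> borel_measurable (sample_law n F)"
        using summand_measurable T by simp
    qed
    have "?E (\<lambda>x. g \<iota> x * g \<kappa> x) =
        ?E (\<lambda>x. ?u x * ?v x - ?E ?v * ?u x - ?E ?u * ?v x + ?E ?u * ?E ?v)"
      by (simp add: g_def algebra_simps)
    also have "\<dots> = ?E (\<lambda>x. ?u x * ?v x) - ?E ?u * ?E ?v"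
      using uv_int summand_integrable[OF T(1)] summand_integrable[OF T(2)]
      by (simp add: S.prob_space)
    also have "\<dots> = 0"
      using summands_uncorrelated[OF T] False T by (auto simp: overlapping_def)
    finally show ?thesis using A by simp
  qed
  have U_eq: "U_statistic n m h (pair_data j k x)
      - mean_under (sample_law n F) (\<lambda>x. U_statistic n m h (pair_data j k x)) = (\<Sum>\<iota>\<in>?T. g \<iota> x) / N" for x
  proof -
    have "mean_under (sample_law n F) (\<lambda>x. U_statistic n m h (pair_data j k x)) =
        (\<Sum>\<iota>\<in>?T. ?E (summand m h j k \<iota>)) / N"
      using mn summand_integrable
      by (simp add: mean_under_def U_statistic_eq_average N_def Bochner_Integration.integral_sum)
    then show ?thesis
      using mn by (simp add: U_statistic_eq_average N_def g_def sum_subtractf diff_divide_distrib)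
  qed
  have "var_under (sample_law n F) (\<lambda>x. U_statistic n m h (pair_data j k x)) =
      ?E (\<lambda>x. (\<Sum>\<iota>\<in>?T. \<Sum>\<kappa>\<in>?T. g \<iota> x * g \<kappa> x) / N\<^sup>2)"
    unfolding var_under_def U_eq by (simp add: power_divide power2_eq_square sum_product)
  also have "\<dots> = (\<Sum>\<iota>\<in>?T. \<Sum>\<kappa>\<in>?T. ?E (\<lambda>x. g \<iota> x * g \<kappa> x)) / N\<^sup>2"
    using gg_int by (simp add: Bochner_Integration.integral_sum)
  also have "\<dots> \<le> (\<Sum>\<iota>\<in>?T. \<Sum>\<kappa>\<in>?T. 4 * A\<^sup>2 * of_bool (\<kappa> \<in> overlapping n m \<iota>)) / N\<^sup>2"
    by (intro divide_right_mono sum_mono cov_le) auto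
  also have "\<dots> = (\<Sum>\<iota>\<in>?T. 4 * A\<^sup>2 * real (card (overlapping n m \<iota>))) / N\<^sup>2"
  proof -
    have "{\<kappa> \<in> ?T. \<kappa> \<in> overlapping n m \<iota>} = overlapping n m \<iota>" for \<iota>
      by (auto simp: overlapping_def)
    then show ?thesis by (simp add: of_bool_def flip: sum_distrib_left sum.inter_filter)
  qed
  also have "\<dots> \<le> (\<Sum>\<iota>\<in>?T. 4 * A\<^sup>2 * ((real m)\<^sup>2 * N / real n)) / N\<^sup>2"
    using card_overlapping mn
    by (intro divide_right_mono sum_mono mult_left_mono) (auto simp: N_def field_simps)
  also have "\<dots> = 4 * A\<^sup>2 * (real m)\<^sup>2 / real n"
    using N by (simp add: power2_eq_square flip: N_def)
  finally show ?thesis .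
qed

end

section \<open>Continuous laws produce no ties\<close>

text \<open>
  The points with \<open>y j = a\<close> and all other coordinates at most \<open>T\<close> have at most the mass by which the
  joint distribution function grows when its \<open>j\<close>-th argument moves from just below \<open>a\<close> to \<open>a\<close>, so
  continuity makes them a null set. Letting \<open>T\<close> grow exhausts the hyperplane \<open>y j = a\<close>.
\<close>

lemma coordinate_atomless:
  assumes F: "F \<in> continuous_laws d" and j: "j < d"
  shows "measure F {y \<in> space F. y j = a} = 0"
proof -
  interpret F: prob_space F using continuous_lawD[OF F] by simp
  note sets_F = continuous_lawD(2)[OF F]
  define H where "H t = F.prob {x \<in> space F. \<forall>i<d. x i \<le> t i}" for t :: "nat \<Rightarrow> real"
  have H_cont: "continuous_on UNIV H"
    using F by (simp add: continuous_laws_def H_def[abs_def])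
  note coord [measurable] = coordinate_measurable[OF sets_F]
  have meas: "{x \<in> space F. \<forall>i<d. x i \<le> t i} \<in> F.events" for t
  proof -
    have "{x \<in> space F. \<forall>i\<in>{..<d}. x i \<le> t i} \<in> F.events"
      using coord by (intro sets.sets_Collect_finite_All) auto
    then show ?thesis by simp
  qed
  define slab where "slab T = {y \<in> space F. y j = a \<and> (\<forall>i<d. i \<noteq> j \<longrightarrow> y i \<le> real T)}" for T :: nat
  have slab_null: "slab T \<in> null_sets F" for T
  proof -
    let ?t = "\<lambda>s. (\<lambda>i. real T)(j := s)"
    have slab_meas: "slab T \<in> F.events"
    proof -
      have "slab T = {y \<in> space F. y j = a} \<inter> {x \<in> space F. \<forall>i<d. x i \<le> ?t a i}"
        by (auto simp: slab_def)
      moreover have "{y \<in> space F. y j = a} \<in> F.events"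
        using coord[OF j] by measurable
      ultimately show ?thesis using meas by auto
    qed
    have "continuous_on UNIV (\<lambda>s. ?t s)"
    proof (rule continuous_on_coordinatewise_then_product)
      show "continuous_on UNIV (\<lambda>s. ?t s i)" for i by (cases "i = j") auto
    qed
    then have "continuous_on UNIV (\<lambda>s. H (?t s))"
      by (rule continuous_on_compose2[OF H_cont]) auto
    then have "isCont (\<lambda>s. H (?t s)) a"
      by (simp add: continuous_on_eq_continuous_at)
    moreover have "(\<lambda>N. a - inverse (real (Suc N))) \<longlonglongrightarrow> a - 0"
      by (intro tendsto_intros LIMSEQ_inverse_real_of_nat)
    ultimately have "(\<lambda>N. H (?t (a - inverse (real (Suc N))))) \<longlonglongrightarrow> H (?t a)"
      by (intro isCont_tendsto_compose[of a "\<lambda>s. H (?t s)"]) auto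
    then have lim: "(\<lambda>N. H (?t a) - H (?t (a - inverse (real (Suc N))))) \<longlonglongrightarrow> H (?t a) - H (?t a)"
      by (intro tendsto_intros)
    have "F.prob (slab T) \<le> H (?t a) - H (?t (a - inverse (real (Suc N))))" for N
    proof -
      let ?s = "a - inverse (real (Suc N))"
      have lt: "?s < a" by simp
      have "H (?t a) - H (?t ?s) =
          F.prob ({x \<in> space F. \<forall>i<d. x i \<le> ?t a i} - {x \<in> space F. \<forall>i<d. x i \<le> ?t ?s i})"
        unfolding H_def
      proof (rule F.finite_measure_Diff[symmetric, OF meas meas], rule subsetI)
        fix x assume "x \<in> {x \<in> space F. \<forall>i<d. x i \<le> ?t ?s i}"
        then show "x \<in> {x \<in> space F. \<forall>i<d. x i \<le> ?t a i}"
          using lt by (auto simp del: fun_upd_apply simp: fun_upd_def split: if_splits intro: order_trans[OF _ less_imp_le[OF lt]])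
      qed
      moreover have "slab T \<subseteq> {x \<in> space F. \<forall>i<d. x i \<le> ?t a i} - {x \<in> space F. \<forall>i<d. x i \<le> ?t ?s i}"
        using lt j by (auto simp: slab_def)
      ultimately show ?thesis
        using F.finite_measure_mono[OF _ sets.Diff[OF meas[of "?t a"] meas[of "?t ?s"]]] by presburger
    qed
    then have "F.prob (slab T) \<le> H (?t a) - H (?t a)"
      using lim by (intro LIMSEQ_le_const[OF lim]) auto
    then have "F.prob (slab T) = 0" by (simp add: measure_le_0_iff)
    then show ?thesis using slab_meas by (auto simp: null_sets_def F.emeasure_eq_measure)
  qed
  have "{y \<in> space F. y j = a} \<subseteq> (\<Union>T. slab T)"
  proof
    fix y assume y: "y \<in> {y \<in> space F. y j = a}"
    obtain T where T: "Max (insert 0 (y ` {..<d})) \<le> real T" using real_arch_simple by blast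
    have "y i \<le> real T" if "i < d" for i
      using that by (intro order_trans[OF Max_ge T]) auto
    with y show "y \<in> (\<Union>T. slab T)" by (auto simp: slab_def)
  qed
  moreover have "(\<Union>T. slab T) \<in> null_sets F" using slab_null by auto
  ultimately have "measure F {y \<in> space F. y j = a} \<le> measure F (\<Union>T. slab T)"
    using slab_null by (intro F.finite_measure_mono) auto
  also have "\<dots> = 0" using \<open>(\<Union>T. slab T) \<in> null_sets F\<close> by (simp add: null_sets_def F.emeasure_eq_measure)
  finally show ?thesis by (simp add: measure_le_0_iff)
qed

lemma (in prob_space) indep_var_of_indep_vars:
  assumes indep: "indep_vars (\<lambda>_. N) X I" and "i \<in> I" "i' \<in> I" "i \<noteq> i'"
  shows "indep_var N (X i) N (X i')"
proof -
  have "indep_var N ((\<lambda>f. f i) \<circ> (\<lambda>\<omega>. restrict (\<lambda>i. X i \<omega>) {i}))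
      N ((\<lambda>f. f i') \<circ> (\<lambda>\<omega>. restrict (\<lambda>i. X i \<omega>) {i'}))"
    using assms by (intro indep_var_compose[OF indep_var_restrict[OF indep]]) auto
  then show ?thesis by (simp add: comp_def)
qed

text \<open>
  By Fubini, the diagonal has the mass obtained by averaging the atoms of \<open>Y\<close> over the law of \<open>X\<close>.
\<close>

lemma (in prob_space) AE_neq_of_indep_atomless:
  fixes X Y :: "'a \<Rightarrow> real"
  assumes indep: "indep_var borel X borel Y" and atomless: "\<And>a. prob {x \<in> space M. Y x = a} = 0"
  shows "AE x in M. X x \<noteq> Y x"
proof -
  note [measurable] = indep_var_rv1[OF indep] indep_var_rv2[OF indep]
  let ?D = "{p :: real \<times> real. fst p = snd p}"
  have D [measurable]: "?D \<in> sets (borel \<Otimes>\<^sub>M borel)"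
    unfolding borel_prod by (intro borel_closed closed_Collect_eq continuous_intros)
  interpret Y: prob_space "distr M borel Y" by (rule prob_space_distr) measurable
  have "emeasure M {x \<in> space M. X x = Y x} =
      emeasure (distr M (borel \<Otimes>\<^sub>M borel) (\<lambda>x. (X x, Y x))) ?D"
    by (subst emeasure_distr) (auto intro!: arg_cong[of _ _ "emeasure M"])
  also have "\<dots> = emeasure (distr M borel X \<Otimes>\<^sub>M distr M borel Y) ?D"
    using indep by (simp add: indep_var_distribution_eq)
  also have "\<dots> = (\<integral>\<^sup>+ a. emeasure (distr M borel Y) (Pair a -` ?D) \<partial>distr M borel X)"
    by (rule Y.emeasure_pair_measure_alt) simp
  also have "\<dots> = (\<integral>\<^sup>+ a. 0 \<partial>distr M borel X)"
  proof (rule nn_integral_cong)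
    fix a
    have "emeasure (distr M borel Y) (Pair a -` ?D) = emeasure M {x \<in> space M. Y x = a}"
      by (subst emeasure_distr) (auto simp: vimage_def intro!: arg_cong[of _ _ "emeasure M"])
    then show "emeasure (distr M borel Y) (Pair a -` ?D) = 0"
      by (simp add: emeasure_eq_measure atomless)
  qed
  finally have "emeasure M {x \<in> space M. X x = Y x} = 0" by simp
  then show ?thesis by (subst AE_iff_measurable[OF _ refl]) auto
qed

lemma AE_distinct_observations:
  assumes F: "F \<in> continuous_laws d" and j: "j < d" and i: "i < n" "i' < n" "i \<noteq> i'"
  shows "AE x in sample_law n F. x i j \<noteq> x i' j"
proof -
  have F': "prob_space F" by (rule continuous_lawD[OF F])
  interpret S: prob_space "sample_law n F" by (rule prob_space_sample_law[OF F'])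
  note coord [measurable] = coordinate_measurable[OF continuous_lawD(2)[OF F] j]
  have "S.indep_vars (\<lambda>_. borel) (\<lambda>i x. x i j) {..<n}"
    using i by (intro S.indep_vars_compose2[OF indep_observations[OF F']]) auto
  then have "S.indep_var borel (\<lambda>x. x i j) borel (\<lambda>x. x i' j)"
    using S.indep_var_of_indep_vars[of borel "\<lambda>i x. x i j"] i by simp
  moreover have "S.prob {x \<in> space (sample_law n F). x i' j = a} = 0" for a
  proof -
    have "S.prob {x \<in> space (sample_law n F). x i' j = a} =
        measure (distr (sample_law n F) F (\<lambda>x. x i')) {y \<in> space F. y j = a}"
      using i by (subst measure_distr)
        (auto simp: sample_law_def space_PiM intro!: arg_cong[of _ _ "measure _"])
    also have "distr (sample_law n F) F (\<lambda>x. x i') = F"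
      unfolding sample_law_def by (rule distr_PiM_component) (use F' i in auto)
    finally show ?thesis by (simp add: coordinate_atomless[OF F j])
  qed
  ultimately show ?thesis by (rule S.AE_neq_of_indep_atomless)
qed

lemma AE_no_ties:
  assumes F: "F \<in> continuous_laws d" and "j < d" "k < d"
  shows "AE x in sample_law n F. no_ties n (pair_data j k x)"
proof -
  have "AE x in sample_law n F. \<forall>p\<in>{p \<in> {..<n} \<times> {..<n}. fst p \<noteq> snd p}.
      x (fst p) j \<noteq> x (snd p) j \<and> x (fst p) k \<noteq> x (snd p) k"
    using assms by (intro AE_finite_allI AE_conjI AE_distinct_observations[OF F])  auto
  then show ?thesis
    by eventually_elim (force simp: no_ties_def pair_data_def inj_on_def)
qed

section \<open>Ranks and relative ranks\<close>

lemma rank_in_less: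
  assumes "i' < n" "y i < y i'"
  shows "rank_in n y i < rank_in n y i'"
  unfolding rank_in_def
proof (rule psubset_card_mono, simp, rule psubsetI)
  show "{l \<in> {..<n}. y l \<le> y i} \<subseteq> {l \<in> {..<n}. y l \<le> y i'}"
    using assms by fastforce
  have "i' \<in> {l \<in> {..<n}. y l \<le> y i'} - {l \<in> {..<n}. y l \<le> y i}" using assms by simp
  then show "{l \<in> {..<n}. y l \<le> y i} \<noteq> {l \<in> {..<n}. y l \<le> y i'}" by blast
qed

lemma rank_in_bounds: "i < n \<Longrightarrow> rank_in n y i \<in> {1..n}"
proof -
  assume "i < n"
  then have "{i' \<in> {..<n}. y i' \<le> y i} \<noteq> {}" by auto
  then have "rank_in n y i \<noteq> 0" by (simp add: rank_in_def)
  moreover have "rank_in n y i \<le> n"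
    unfolding rank_in_def using card_mono[of "{..<n}" "{i' \<in> {..<n}. y i' \<le> y i}"] by auto
  ultimately show ?thesis by simp
qed

lemma bij_betw_rank_in:
  assumes "inj_on y {..<n}"
  shows "bij_betw (rank_in n y) {..<n} {1..n}"
proof -
  have inj: "inj_on (rank_in n y) {..<n}"
  proof (rule linorder_inj_onI')
    fix i i' assume i: "i \<in> {..<n}" "i' \<in> {..<n}" "i < i'"
    then have "y i \<noteq> y i'" using assms by (auto dest: inj_onD)
    then show "rank_in n y i \<noteq> rank_in n y i'"
      using rank_in_less[of i n y i'] rank_in_less[of i' n y i] i by (cases "y i < y i'") auto
  qed
  moreover have "rank_in n y ` {..<n} \<subseteq> {1..n}" using rank_in_bounds by blast
  then have "rank_in n y ` {..<n} = {1..n}"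
    using card_image[OF inj] by (intro card_subset_eq) auto
  ultimately show ?thesis by (simp add: bij_betw_def)
qed

lemma rank_in_cong:
  assumes "\<And>i'. i' < n \<Longrightarrow> y i' \<le> y i \<longleftrightarrow> w i' \<le> w i"
  shows "rank_in n y i = rank_in n w i"
proof -
  have "{i' \<in> {..<n}. y i' \<le> y i} = {i' \<in> {..<n}. w i' \<le> w i}"
    using assms by blast
  then show ?thesis by (simp add: rank_in_def)
qed

text \<open>
  Absence of ties makes the first ranks a bijection onto \<open>{1..n}\<close>, so that the definite description in
  \<open>relative_rank\<close> denotes an actual observation index.
\<close>

lemma relative_rank_cong:
  assumes "no_ties n z" and i: "i \<in> {1..n}"
    and order: "\<And>i i'. i < n \<Longrightarrow> i' < n \<Longrightarrow> fst (z i') \<le> fst (z i) \<longleftrightarrow> fst (z' i') \<le> fst (z' i)"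
      "\<And>i i'. i < n \<Longrightarrow> i' < n \<Longrightarrow> snd (z i') \<le> snd (z i) \<longleftrightarrow> snd (z' i') \<le> snd (z' i)"
  shows "relative_rank n z i = relative_rank n z' i"
proof -
  let ?r = "\<lambda>z. rank_in n (\<lambda>l. fst (z l))"
  have r_eq: "?r z i' = ?r z' i'" if "i' < n" for i'
    using order(1) that by (intro rank_in_cong) auto
  then have eq: "(\<lambda>i'. i' < n \<and> ?r z i' = i) = (\<lambda>i'. i' < n \<and> ?r z' i' = i)"
    by (auto simp: fun_eq_iff)
  define i0 where "i0 = (THE i'. i' < n \<and> ?r z i' = i)"
  have bij: "bij_betw (?r z) {..<n} {1..n}"
    using assms(1) by (intro bij_betw_rank_in) (simp add: no_ties_def)
  have "\<exists>!i'. i' < n \<and> ?r z i' = i"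
  proof (rule ex_ex1I)
    have "i \<in> ?r z ` {..<n}" using bij i by (simp only: bij_betw_imp_surj_on)
    then show "\<exists>i'. i' < n \<and> ?r z i' = i" by blast
    show "a = b" if "a < n \<and> ?r z a = i" "b < n \<and> ?r z b = i" for a b
      using inj_onD[OF bij_betw_imp_inj_on[OF bij], of a b] that by simp
  qed
  from theI'[OF this] have "i0 < n" unfolding i0_def by blast
  then have "rank_in n (\<lambda>l. snd (z l)) i0 = rank_in n (\<lambda>l. snd (z' l)) i0"
    using order(2) by (intro rank_in_cong) auto
  then show ?thesis
    by (simp add: relative_rank_def i0_def eq)
qed

section \<open>Every rank pattern has positive probability\<close>

text \<open>
  The points \<open>t i\<close> are quantiles at the levels \<open>(i + 1) / (n + 2)\<close>; these lie strictly between \<open>0\<close> and \<open>1\<close>,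
  so the intermediate value theorem provides them.
\<close>

lemma (in real_distribution) exists_interval_grid:
  assumes atomless: "\<And>a. measure M {a} = 0"
  shows "\<exists>t. (\<forall>i j. i \<le> j \<longrightarrow> j \<le> n \<longrightarrow> t i \<le> t j) \<and> (\<forall>i<n. measure M {t i<..t (Suc i)} > 0)"
proof -
  let ?p = "\<lambda>i. real (Suc i) / real (n + 2)"
  have "\<exists>t. cdf M t = ?p i" if "i \<le> n" for i
  proof -
    have p: "0 < ?p i" "?p i < 1" using that by (auto simp: field_simps)
    obtain a where a: "cdf M a < ?p i"
      using eventually_happens[OF order_tendstoD(2)[OF cdf_lim_at_bot p(1)]] by auto
    obtain b where b: "cdf M b > ?p i"
      using eventually_happens[OF order_tendstoD(1)[OF cdf_lim_at_top_prob p(2)]] by auto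
    have "a \<le> b" using cdf_nondecreasing[of b a] a b by linarith
    moreover have "\<forall>x. a \<le> x \<and> x \<le> b \<longrightarrow> isCont (cdf M) x" by (simp add: isCont_cdf atomless)
    ultimately show ?thesis using IVT[of "cdf M" a "?p i" b] a b by auto
  qed
  then obtain t where t: "\<And>i. i \<le> n \<Longrightarrow> cdf M (t i) = ?p i" by metis
  have lt: "t i < t j" if "i < j" "j \<le> n" for i j
  proof (rule ccontr)
    assume "\<not> t i < t j"
    then have "cdf M (t j) \<le> cdf M (t i)" by (intro cdf_nondecreasing) simp
    then have "?p j \<le> ?p i" using t[of i] t[of j] that by simp
    then have "real (Suc j) \<le> real (Suc i)" by (subst (asm) divide_le_cancel) simp
    with that show False by simp
  qed
  moreover have "measure M {t i<..t (Suc i)} > 0" if "i < n" for i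
  proof -
    have "?p i < ?p (Suc i)" by (rule divide_strict_right_mono) simp_all
    then have "cdf M (t i) < cdf M (t (Suc i))" using t[of i] t[of "Suc i"] that by simp
    then show ?thesis using cdf_diff_eq[OF lt[of i "Suc i"]] that by simp
  qed
  ultimately show ?thesis
    by (intro exI[of _ t]) (auto simp: le_less)
qed

lemma coordinate_interval_grid:
  assumes F: "F \<in> continuous_laws d" and j: "j < d"
  shows "\<exists>t. (\<forall>i i'. i \<le> i' \<longrightarrow> i' \<le> n \<longrightarrow> t i \<le> t i') \<and>
    (\<forall>i<n. measure F {y \<in> space F. y j \<in> {t i<..t (Suc i)}} > 0)"
proof -
  interpret F: prob_space F using continuous_lawD[OF F] by simp
  note coord [measurable] = coordinate_measurable[OF continuous_lawD(2)[OF F] j]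
  let ?M = "distr F borel (\<lambda>y. y j)"
  interpret M: real_distribution ?M by simp
  have eq: "measure ?M B = measure F {y \<in> space F. y j \<in> B}" if "B \<in> sets borel" for B
    using that by (subst measure_distr) (auto intro!: arg_cong[of _ _ "measure F"])
  then have "measure ?M {a} = 0" for a
    using coordinate_atomless[OF F j, of a] by simp
  from M.exists_interval_grid[OF this, of n] show ?thesis
    using eq by simp
qed

text \<open>
  Putting the observation of rank \<open>r\<close> into the \<open>r\<close>-th interval of the grid reproduces the order of \<open>y\<close>.
\<close>

lemma grid_order:
  fixes t :: "nat \<Rightarrow> real"
  assumes mono: "\<And>i i'. i \<le> i' \<Longrightarrow> i' \<le> n \<Longrightarrow> t i \<le> t i'"
    and inj: "inj_on y {..<n}"
    and v: "\<And>i. i < n \<Longrightarrow> v i \<in> {t (rank_in n y i - 1)<..t (rank_in n y i)}"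
    and i: "i < n" "i' < n"
  shows "v i' \<le> v i \<longleftrightarrow> y i' \<le> y i"
proof -
  have *: "v a < v b" if "a < n" "b < n" "y a < y b" for a b
  proof -
    have "v a \<le> t (rank_in n y a)" using v that by simp
    also have "\<dots> \<le> t (rank_in n y b - 1)"
      using rank_in_less[of b n y a] rank_in_bounds[of b n y] that by (intro mono) auto
    also have "\<dots> < v b" using v that by simp
    finally show ?thesis .
  qed
  show ?thesis
    using *[OF i] *[OF i(2,1)] inj_onD[OF inj, of i i'] i by fastforce
qed

text \<open>
  Fix a box that confines coordinate \<open>j\<close> of each observation to the grid interval given by its first
  rank in \<open>z\<close>, and coordinate \<open>k\<close> to the one given by its second rank. Under the null hypothesis the
  probability of the box is a product of positive factors, so the box cannot avoid an almost sure
  event, and every point of it has the ranks of \<open>z\<close>.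
\<close>

lemma exists_sample_with_ranks:
  assumes F: "F \<in> null_laws d" and j: "j < d" and k: "k < d" and jk: "j \<noteq> k"
    and z: "no_ties n z" and P: "AE x in sample_law n F. P x"
  shows "\<exists>x. P x \<and> (\<forall>i<n. \<forall>i'<n. (x i' j \<le> x i j \<longleftrightarrow> fst (z i') \<le> fst (z i)) \<and>
    (x i' k \<le> x i k \<longleftrightarrow> snd (z i') \<le> snd (z i)))"
proof -
  have F_cont: "F \<in> continuous_laws d" using F by (simp add: null_laws_def)
  interpret F: prob_space F using continuous_lawD[OF F_cont] by simp
  have F': "prob_space F" by (rule F.prob_space_axioms)
  interpret S: prob_space "sample_law n F" by (rule prob_space_sample_law[OF F'])
  interpret product: finite_product_prob_space "\<lambda>_. F" "{..<n}" by standard simp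
  note sets_F = continuous_lawD(2)[OF F_cont]
  note [measurable] = coordinate_measurable[OF sets_F j] coordinate_measurable[OF sets_F k]
  obtain t where t: "\<And>i i'. i \<le> i' \<Longrightarrow> i' \<le> n \<Longrightarrow> t i \<le> t i'"
      "\<And>i. i < n \<Longrightarrow> F.prob {y \<in> space F. y j \<in> {t i<..t (Suc i)}} > 0"
    using coordinate_interval_grid[OF F_cont j, of n] by blast
  obtain s where s: "\<And>i i'. i \<le> i' \<Longrightarrow> i' \<le> n \<Longrightarrow> s i \<le> s i'"
      "\<And>i. i < n \<Longrightarrow> F.prob {y \<in> space F. y k \<in> {s i<..s (Suc i)}} > 0"
    using coordinate_interval_grid[OF F_cont k, of n] by blast
  define p where "p i = rank_in n (\<lambda>l. fst (z l)) i" for i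
  define q where "q i = rank_in n (\<lambda>l. snd (z l)) i" for i
  define I where "I i = {t (p i - 1)<..t (p i)}" for i
  define J where "J i = {s (q i - 1)<..s (q i)}" for i
  define A where "A i = {y \<in> space F. y j \<in> I i} \<inter> {y \<in> space F. y k \<in> J i}" for i
  have IJ [measurable]: "I i \<in> sets borel" "J i \<in> sets borel" for i by (auto simp: I_def J_def)
  have A_meas [measurable]: "A i \<in> F.events" for i unfolding A_def by measurable
  have A_pos: "F.prob (A i) > 0" if "i < n" for i
  proof -
    have "F.indep_var borel (\<lambda>y. y j) borel (\<lambda>y. y k)"
      using F j k jk F.indep_var_of_indep_vars[of borel "\<lambda>j x. x j" "{..<d}"] by (simp add: null_laws_def)
    then have "F.prob ((\<lambda>y. (y j, y k)) -` (I i \<times> J i) \<inter> space F) =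
        F.prob ((\<lambda>y. y j) -` I i \<inter> space F) * F.prob ((\<lambda>y. y k) -` J i \<inter> space F)"
      by (rule F.indep_varD) auto
    also have "(\<lambda>y. (y j, y k)) -` (I i \<times> J i) \<inter> space F = A i" by (auto simp: A_def)
    also have "(\<lambda>y. y j) -` I i \<inter> space F = {y \<in> space F. y j \<in> I i}" by auto
    also have "(\<lambda>y. y k) -` J i \<inter> space F = {y \<in> space F. y k \<in> J i}" by auto
    finally show ?thesis
      using t(2)[of "p i - 1"] s(2)[of "q i - 1"] rank_in_bounds[OF that, of "\<lambda>l. fst (z l)"]
        rank_in_bounds[OF that, of "\<lambda>l. snd (z l)"]
      by (auto simp: I_def J_def p_def q_def)
  qed
  have "S.prob (Pi\<^sub>E {..<n} A) = (\<Prod>i<n. F.prob (A i))"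
    unfolding sample_law_def by (rule product.finite_measure_PiM_emb) simp
  then have "S.prob (Pi\<^sub>E {..<n} A) > 0" using A_pos by (simp only:) (rule prod_pos, simp)
  moreover have "Pi\<^sub>E {..<n} A \<in> S.events"
    unfolding sample_law_def by (intro sets_PiM_I_finite) auto
  ultimately have "\<not> (AE x in sample_law n F. x \<notin> Pi\<^sub>E {..<n} A)"
    using S.prob_eq_0 by force
  moreover have "AE x in sample_law n F. x \<notin> Pi\<^sub>E {..<n} A" if "\<And>x. P x \<Longrightarrow> x \<notin> Pi\<^sub>E {..<n} A"
    using P by (rule eventually_mono) (rule that)
  ultimately obtain x where x: "P x" "x \<in> Pi\<^sub>E {..<n} A" by blast
  have "(x i' j \<le> x i j \<longleftrightarrow> fst (z i') \<le> fst (z i)) \<and> (x i' k \<le> x i k \<longleftrightarrow> snd (z i') \<le> snd (z i))"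
    if "i < n" "i' < n" for i i'
    using z x(2) that
    by (intro conjI grid_order[OF t(1), of n] grid_order[OF s(1), of n])
      (auto simp: no_ties_def A_def I_def J_def p_def q_def PiE_iff)
  with x show ?thesis by blast
qed

section \<open>Degenerate statistics\<close>

text \<open>
  With null variance zero, the statistic is almost surely constant under \<open>P0\<close>. Since a rank-type
  statistic is determined by the relative ranks and all rank patterns occur with positive probability,
  that constant is its value on all data without ties.
\<close>

lemma U_constant_of_null_variance:
  assumes kernel: "rank_type_kernel n m h" "\<forall>z \<in> {..<m} \<rightarrow>\<^sub>E UNIV. \<bar>h z\<bar> \<le> A" and mn: "m < n"
    and P0: "P0 \<in> null_laws d" and d: "2 \<le> d" and var: "sigma2_U n m h P0 = 0"
  obtains u where "\<And>z. no_ties n z \<Longrightarrow> U_statistic n m h z = u"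
proof -
  have P0_cont: "P0 \<in> continuous_laws d" using P0 by (simp add: null_laws_def)
  interpret bounded_pair_kernel P0 n m d h A 0 1
    using continuous_lawD[OF P0_cont] kernel mn d
    by (auto simp: bounded_pair_kernel_def bounded_pair_kernel_axioms_def rank_type_kernel_def)
  let ?U = "\<lambda>x. U_statistic n m h (pair_data 0 1 x)"
  define u where "u = S.expectation ?U"
  have "S.expectation (\<lambda>x. (?U x - u)\<^sup>2) = 0"
    using var mn by (simp add: sigma2_U_def var_under_def mean_under_def u_def)
  then have "AE x in sample_law n P0. (?U x - u)\<^sup>2 = 0"
    using integral_nonneg_eq_0_iff_AE[OF U_centred_integrable_sq] by simp
  then have AE: "AE x in sample_law n P0. ?U x = u \<and> no_ties n (pair_data 0 1 x)"
    using AE_no_ties[OF P0_cont, of 0 1 n] d by auto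
  have "U_statistic n m h z = u" if z: "no_ties n z" for z
  proof -
    obtain x where x: "?U x = u" "no_ties n (pair_data 0 1 x)"
      and order: "\<And>i i'. i < n \<Longrightarrow> i' < n \<Longrightarrow> x i' 0 \<le> x i 0 \<longleftrightarrow> fst (z i') \<le> fst (z i)"
        "\<And>i i'. i < n \<Longrightarrow> i' < n \<Longrightarrow> x i' 1 \<le> x i 1 \<longleftrightarrow> snd (z i') \<le> snd (z i)"
      using exists_sample_with_ranks[OF P0 _ _ _ z AE, of 0 1] d by auto
    have "relative_rank n (pair_data 0 1 x) i = relative_rank n z i" if "i \<in> {1..n}" for i
      using order by (intro relative_rank_cong x that) (auto simp: pair_data_def)
    then have "?U x = U_statistic n m h z"
      using kernel(1) x(2) z unfolding rank_type_kernel_def by blast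
    with x show ?thesis by simp
  qed
  then show thesis by (rule that)
qed

text \<open>
  A degenerate statistic has the same mean under every continuous law, so it admits no alternatives.
  This is what excludes a zero denominator in the test statistic.
\<close>

lemma mean_U_eq_of_constant:
  assumes kernel: "rank_type_kernel n m h" "\<forall>z \<in> {..<m} \<rightarrow>\<^sub>E UNIV. \<bar>h z\<bar> \<le> A" and mn: "m < n"
    and F: "F \<in> continuous_laws d" and jk: "j < d" "k < d"
    and const: "\<And>z. no_ties n z \<Longrightarrow> U_statistic n m h z = u"
  shows "mean_under (sample_law n F) (\<lambda>x. U_statistic n m h (pair_data j k x)) = u"
proof -
  interpret bounded_pair_kernel F n m d h A j k
    using continuous_lawD[OF F] kernel mn jk
    by (auto simp: bounded_pair_kernel_def bounded_pair_kernel_axioms_def rank_type_kernel_def)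
  have "S.expectation (\<lambda>x. U_statistic n m h (pair_data j k x)) = S.expectation (\<lambda>x. u)"
    using AE_no_ties[OF F jk, of n] by (intro integral_cong_AE U_measurable) (auto elim!: eventually_mono simp: const)
  then show ?thesis by (simp add: mean_under_def S.prob_space)
qed

section \<open>Power of the test\<close>

lemma finite_index_pairs: "finite {p :: nat \<times> nat. fst p < snd p \<and> snd p < d}"
  by (rule finite_subset[of _ "{..<d} \<times> {..<d}"]) auto

lemma pairs_as_image:
  fixes f :: "nat \<Rightarrow> nat \<Rightarrow> real"
  shows "{f j k | j k. j < k \<and> k < d} = (\<lambda>p. f (fst p) (snd p)) ` {p. fst p < snd p \<and> snd p < d}"
  by (auto simp: image_iff intro!: exI)

lemma finite_index_pair_values: "finite {f j k | j k. j < k \<and> k < (d :: nat)}"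
  for f :: "nat \<Rightarrow> nat \<Rightarrow> real"
  unfolding pairs_as_image by (intro finite_imageI finite_index_pairs)

lemma U_test_event_measurable:
  assumes kernel: "rank_type_kernel n m h" "\<forall>z \<in> {..<m} \<rightarrow>\<^sub>E UNIV. \<bar>h z\<bar> \<le> A" and mn: "m < n"
    and F: "F \<in> continuous_laws d"
  shows "{x \<in> space (sample_law n F). U_test \<alpha> n d m h P0 x = 1} \<in> sets (sample_law n F)"
proof -
  have "(\<lambda>x. \<bar>centred_U n m h P0 (fst p) (snd p) x\<bar>) \<in> borel_measurable (sample_law n F)"
    if p: "p \<in> {p. fst p < snd p \<and> snd p < d}" for p
  proof -
    interpret bounded_pair_kernel F n m d h A "fst p" "snd p"
      using continuous_lawD[OF F] kernel mn p
      by (auto simp: bounded_pair_kernel_def bounded_pair_kernel_axioms_def rank_type_kernel_def)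
    show ?thesis
      unfolding centred_U_def using U_measurable by simp
  qed
  then have [measurable]: "max_U n d m h P0 \<in> borel_measurable (sample_law n F)"
    unfolding max_U_def[abs_def] pairs_as_image by (intro borel_measurable_Max finite_index_pairs)
  have "{x \<in> space (sample_law n F). U_test \<alpha> n d m h P0 x = 1} =
    {x \<in> space (sample_law n F). real n * (max_U n d m h P0 x)\<^sup>2 / sigma2_U n m h P0
                - 4 * ln (real d) + ln (ln (real d)) \<ge> gumbel_quantile \<alpha>}"
    by (auto simp: U_test_def)
  also have "\<dots> \<in> sets (sample_law n F)" by measurable
  finally show ?thesis .
qed

text \<open>
  Some pair \<open>(j, k)\<close> has its mean shifted by at least
  \<open>\<delta> = B \<sigma> \<surd>(ln d / n)\<close> with \<open>\<sigma>\<^sup>2 = sigma2_tilde_U n m h P0\<close>, while its standard deviation is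
  at most \<open>\<surd>(C / n)\<close>. By Chebyshev's inequality the statistic stays within \<open>\<delta> / 2\<close> of its mean except with probability
  at most \<open>4 C / (n \<delta>\<^sup>2) \<le> 1 / (5 ln d)\<close>. Outside this
  exceptional event the maximum is at least \<open>\<delta> / 2\<close>, and since
  \<open>sigma2_U n m h P0 \<le> C\<close> as well, the normalised squared maximum is at least
  \<open>5 ln d\<close>. The constant \<open>20\<close> is chosen so that this exceeds \<open>4 ln d\<close> by a full \<open>ln d\<close>, which
  absorbs the quantile.
\<close>

lemma U_test_power_at_alternative:
  assumes kernel: "rank_type_kernel n m h" "\<forall>z \<in> {..<m} \<rightarrow>\<^sub>E UNIV. \<bar>h z\<bar> \<le> A" and mn: "m < n"
    and P0: "P0 \<in> null_laws d"
    and C: "4 * A\<^sup>2 * (real m)\<^sup>2 \<le> C" "C > 0" and B: "B > 0" "20 * C \<le> B\<^sup>2 * sigma2_tilde_U n m h P0"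
    and d: "d \<ge> 3" "gumbel_quantile \<alpha> \<le> ln (real d) + ln (ln (real d))"
    and F_alt: "F \<in> U_alternatives n d m h P0 B"
  shows "1 - 1 / (5 * ln (real d)) \<le>
    measure (sample_law n F) {x \<in> space (sample_law n F). U_test \<alpha> n d m h P0 x = 1}"
proof -
  define s where "s = sigma2_tilde_U n m h P0"
  have n: "real n > 0" using mn by simp
  have ln_d: "ln (real d) > 0" using d by simp
  have s: "s > 0" using B C unfolding s_def by (smt (verit) zero_le_power2 mult_nonneg_nonpos)
  have P0_cont: "P0 \<in> continuous_laws d" using P0 by (simp add: null_laws_def)
  have F: "F \<in> continuous_laws d" using F_alt by (simp add: U_alternatives_def)
  define \<Delta> where "\<Delta> = {\<bar>U_mean n m h P0 F j k\<bar> | j k. j < k \<and> k < d}"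
  have "\<bar>U_mean n m h P0 F 0 1\<bar> \<in> \<Delta>" using d by (force simp: \<Delta>_def)
  then have "Max \<Delta> \<in> \<Delta>" unfolding \<Delta>_def by (intro Max_in finite_index_pair_values) auto
  moreover have "Max \<Delta> \<ge> B * sqrt (ln (real d) / real n)"
    using F_alt by (simp add: U_alternatives_def alternative_matrices_def \<Delta>_def)
  ultimately obtain j k where jk: "j < k" "k < d"
    and U_mean_ge: "B * sqrt (ln (real d) / real n) \<le> \<bar>U_mean n m h P0 F j k\<bar>"
    unfolding \<Delta>_def by auto
  then have j: "j < d" by simp
  interpret bounded_pair_kernel F n m d h A j k
    using continuous_lawD[OF F] kernel mn jk
    by (auto simp: bounded_pair_kernel_def bounded_pair_kernel_axioms_def rank_type_kernel_def)
  interpret null: bounded_pair_kernel P0 n m d h A 0 1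
    using continuous_lawD[OF P0_cont] kernel mn d
    by (auto simp: bounded_pair_kernel_def bounded_pair_kernel_axioms_def rank_type_kernel_def)
  let ?U = "\<lambda>x. U_statistic n m h (pair_data j k x)"
  define e where "e = mean_under (sample_law n F) ?U"
  define e0 where "e0 = mean_under (sample_law n P0) ?U"
  have U_mean_eq: "U_mean n m h P0 F j k = (e - e0) / sqrt s"
  proof -
    have "U_mean n m h P0 F j k = S.expectation (\<lambda>x. (?U x - e0) / sqrt s)"
      using jk by (simp add: U_mean_def mean_under_def U_hat_def centred_U_def e0_def s_def)
    also have "\<dots> = (S.expectation ?U - e0) / sqrt s"
      using U_integrable by (simp add: S.prob_space)
    finally show ?thesis by (simp add: e_def mean_under_def)
  qed
  have thr_pos: "B * sqrt (ln (real d) / real n) > 0" using B n ln_d by simp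
  (* A zero variance would force the two means of the statistic to coincide. *)
  have sigma_pos: "sigma2_U n m h P0 > 0"
  proof (rule ccontr)
    assume "\<not> sigma2_U n m h P0 > 0"
    moreover have "sigma2_U n m h P0 \<ge> 0" by (simp add: sigma2_U_def var_under_def)
    ultimately have "sigma2_U n m h P0 = 0" by simp
    then obtain u where u: "\<And>z. no_ties n z \<Longrightarrow> U_statistic n m h z = u"
      using U_constant_of_null_variance[OF kernel mn P0 _ _] d by auto
    have "e = u" "e0 = u"
      unfolding e_def e0_def using mean_U_eq_of_constant[OF kernel mn _ j jk(2) u] F P0_cont by auto
    with U_mean_eq U_mean_ge thr_pos show False by simp
  qed
  have sigma_le: "sigma2_U n m h P0 \<le> C"
    using null.variance_U_le n C(1) by (simp add: sigma2_U_def field_simps)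
  define \<delta> where "\<delta> = B * sqrt (ln (real d) / real n) * sqrt s"
  have \<delta>: "\<delta> > 0" "\<delta> \<le> \<bar>e - e0\<bar>"
    using thr_pos s U_mean_ge by (simp_all add: \<delta>_def U_mean_eq abs_divide pos_le_divide_eq)
  have \<delta>_sq: "20 * C * ln (real d) / real n \<le> \<delta>\<^sup>2"
  proof -
    have "\<delta>\<^sup>2 = (B\<^sup>2 * s) * (ln (real d) / real n)"
      using s ln_d n by (simp add: \<delta>_def power_mult_distrib)
    moreover have "20 * C * (ln (real d) / real n) \<le> (B\<^sup>2 * s) * (ln (real d) / real n)"
      using B ln_d n by (intro mult_right_mono) (auto simp: s_def)
    ultimately show ?thesis by simp
  qed
  have sub: "space (sample_law n F) - {x \<in> space (sample_law n F). \<delta> / 2 \<le> \<bar>?U x - S.expectation ?U\<bar>}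
      \<subseteq> {x \<in> space (sample_law n F). U_test \<alpha> n d m h P0 x = 1}"
  proof
    fix x
    assume x: "x \<in> space (sample_law n F) - {x \<in> space (sample_law n F). \<delta> / 2 \<le> \<bar>?U x - S.expectation ?U\<bar>}"
    then have "\<bar>?U x - e\<bar> < \<delta> / 2" by (auto simp: e_def mean_under_def)
    then have "\<delta> / 2 \<le> \<bar>?U x - e0\<bar>"
      using \<delta>(2) by linarith
    then have "\<delta> / 2 \<le> \<bar>centred_U n m h P0 j k x\<bar>"
      by (simp only: centred_U_def e0_def)
    also have "\<dots> \<le> max_U n d m h P0 x"
      unfolding max_U_def using jk by (intro Max_ge finite_index_pair_values) auto
    finally have "(\<delta> / 2)\<^sup>2 \<le> (max_U n d m h P0 x)\<^sup>2"
      using \<delta>(1) by (intro power_mono) auto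
    then have "real n * (\<delta>\<^sup>2 / 4) \<le> real n * (max_U n d m h P0 x)\<^sup>2"
      by (intro mult_left_mono) (auto simp: power_divide)
    moreover have "5 * ln (real d) * C \<le> real n * (\<delta>\<^sup>2 / 4)"
      using \<delta>_sq n by (simp add: field_simps)
    moreover have "5 * ln (real d) * sigma2_U n m h P0 \<le> 5 * ln (real d) * C"
      using sigma_le ln_d by (intro mult_left_mono) auto
    ultimately have "5 * ln (real d) * sigma2_U n m h P0 \<le> real n * (max_U n d m h P0 x)\<^sup>2"
      by linarith
    then have "5 * ln (real d) \<le> real n * (max_U n d m h P0 x)\<^sup>2 / sigma2_U n m h P0"
      using sigma_pos by (simp add: pos_le_divide_eq)
    then show "x \<in> {x \<in> space (sample_law n F). U_test \<alpha> n d m h P0 x = 1}"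
      using d(2) x by (simp add: U_test_def)
  qed
  have "S.prob {x \<in> space (sample_law n F). \<delta> / 2 \<le> \<bar>?U x - S.expectation ?U\<bar>} \<le> S.variance ?U / (\<delta> / 2)\<^sup>2"
    using \<delta>(1) U_centred_integrable_sq[of 0]
    by (intro S.Chebyshev_inequality U_measurable) auto
  also have "S.variance ?U \<le> C / real n"
    using variance_U_le C(1) n unfolding var_under_def mean_under_def
    by (elim order_trans) (intro divide_right_mono, auto)
  then have "S.variance ?U / (\<delta> / 2)\<^sup>2 \<le> (C / real n) / (\<delta> / 2)\<^sup>2"
    by (rule divide_right_mono) simp
  also have "\<dots> \<le> (C / real n) / (5 * C * ln (real d) / real n)"
    using \<delta>_sq C ln_d n \<delta>(1) by (intro divide_left_mono) (auto simp: power_divide)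
  also have "\<dots> = 1 / (5 * ln (real d))"
    using C n by simp
  finally have "1 - 1 / (5 * ln (real d)) \<le>
      1 - S.prob {x \<in> space (sample_law n F). \<delta> / 2 \<le> \<bar>?U x - S.expectation ?U\<bar>}"
    by simp
  also have "\<dots> = S.prob (space (sample_law n F) - {x \<in> space (sample_law n F). \<delta> / 2 \<le> \<bar>?U x - S.expectation ?U\<bar>})"
    using U_measurable by (intro S.prob_compl[symmetric]) measurable
  also have "\<dots> \<le> S.prob {x \<in> space (sample_law n F). U_test \<alpha> n d m h P0 x = 1}"
    by (intro S.finite_measure_mono sub U_test_event_measurable[OF kernel mn F])
  finally show ?thesis .
qed

theorem theorem4:
  fixes m :: nat and A3 A4 :: real
  assumes "A3 > 0" and "A4 > 0"
  shows "\<exists>B2>0. \<forall>(\<alpha> :: real) (d :: nat \<Rightarrow> nat)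
           (h :: nat \<Rightarrow> (nat \<Rightarrow> real \<times> real) \<Rightarrow> real) (P0 :: nat \<Rightarrow> (nat \<Rightarrow> real) measure).
           0 < \<alpha> \<longrightarrow> \<alpha> < 1 \<longrightarrow>
           filterlim d at_top at_top \<longrightarrow>
           (\<forall>n. P0 n \<in> null_laws (d n)) \<longrightarrow>
           (\<forall>n>m. rank_type_kernel n m (h n)) \<longrightarrow>
           (\<forall>n>m. \<forall>z \<in> {..<m} \<rightarrow>\<^sub>E UNIV. \<bar>h n z\<bar> \<le> A3) \<longrightarrow>
           (\<lambda>n. sigma2_tilde_U n m (h n) (P0 n)) \<sim>[at_top] (\<lambda>_. A4) \<longrightarrow>
           (\<lambda>n. min_power \<alpha> n (d n) m (h n) (P0 n) B2) \<longlonglongrightarrow> 1"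
proof -
  (* The summand 1 keeps C positive, and with it the constant B, when m = 0. *)
  define C where "C = 4 * A3\<^sup>2 * (real m)\<^sup>2 + 1"
  have C: "4 * A3\<^sup>2 * (real m)\<^sup>2 \<le> C" "C > 0"
    by (auto simp: C_def intro!: add_nonneg_pos)
  (* Eventually sigma2_tilde_U exceeds A4 / 2, so that B\<^sup>2 * sigma2_tilde_U is at least 20 * C. *)
  define B where "B = sqrt (40 * C / A4)"
  have B: "B > 0" "B\<^sup>2 = 40 * C / A4"
    using C \<open>A4 > 0\<close> by (simp_all add: B_def)
  show ?thesis
  proof (intro exI[of _ B] conjI allI impI B(1))
    fix \<alpha> :: real and d :: "nat \<Rightarrow> nat" and h :: "nat \<Rightarrow> (nat \<Rightarrow> real \<times> real) \<Rightarrow> real"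
      and P0 :: "nat \<Rightarrow> (nat \<Rightarrow> real) measure"
    assume d: "filterlim d at_top at_top" and P0: "\<forall>n. P0 n \<in> null_laws (d n)"
      and rank: "\<forall>n>m. rank_type_kernel n m (h n)"
      and bound: "\<forall>n>m. \<forall>z \<in> {..<m} \<rightarrow>\<^sub>E UNIV. \<bar>h n z\<bar> \<le> A3"
      and var: "(\<lambda>n. sigma2_tilde_U n m (h n) (P0 n)) \<sim>[at_top] (\<lambda>_. A4)"
    have "(\<lambda>n. sigma2_tilde_U n m (h n) (P0 n)) \<longlonglongrightarrow> A4"
      using var by (rule asymp_equivD_const)
    then have ev_var: "eventually (\<lambda>n. A4 / 2 < sigma2_tilde_U n m (h n) (P0 n)) sequentially"
      using \<open>A4 > 0\<close> by (intro order_tendstoD) auto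
    have ln_d: "filterlim (\<lambda>n. ln (real (d n))) at_top sequentially"
      by (intro filterlim_compose[OF ln_at_top] filterlim_compose[OF filterlim_real_sequentially d])
    then have "filterlim (\<lambda>n. ln (real (d n)) + ln (ln (real (d n)))) at_top sequentially"
      by (intro filterlim_at_top_add_at_top filterlim_compose[OF ln_at_top ln_d])
    then have ev_quantile:
      "eventually (\<lambda>n. gumbel_quantile \<alpha> \<le> ln (real (d n)) + ln (ln (real (d n)))) sequentially"
      by (simp add: filterlim_at_top)
    have ev_d: "eventually (\<lambda>n. 3 \<le> d n) sequentially"
      using d by (simp add: filterlim_at_top)
    have lower: "eventually (\<lambda>n. 1 - 1 / (5 * ln (real (d n))) \<le> min_power \<alpha> n (d n) m (h n) (P0 n) B) sequentially"
      using ev_var ev_quantile ev_d eventually_gt_at_top[of m]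
    proof eventually_elim
      case (elim n)
      have "20 * C \<le> B\<^sup>2 * sigma2_tilde_U n m (h n) (P0 n)"
        using elim(1) C \<open>A4 > 0\<close> by (simp add: B(2) field_simps)
      then have power: "1 - 1 / (5 * ln (real (d n))) \<le> measure (sample_law n F)
          {x \<in> space (sample_law n F). U_test \<alpha> n (d n) m (h n) (P0 n) x = 1}"
        if "F \<in> U_alternatives n (d n) m (h n) (P0 n) B" for F
        using U_test_power_at_alternative[OF _ _ elim(4) _ C B(1) _ elim(3,2) that] rank bound P0 elim(4)
        by blast
      have d_large: "1 - 1 / (5 * ln (real (d n))) \<le> 1" using elim(3) by simp
      show ?case
        unfolding min_power_def using power d_large by (intro cInf_greatest) (auto simp del: One_nat_def)
    qed
    have upper: "min_power \<alpha> n (d n) m (h n) (P0 n) B \<le> 1" for n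
      unfolding min_power_def by (intro cInf_lower bdd_belowI[of _ 0]) auto
    have "(\<lambda>n. 1 - 1 / (5 * ln (real (d n)))) \<longlonglongrightarrow> 1 - 0"
      by (intro tendsto_diff tendsto_const tendsto_divide_0[OF tendsto_const]
          filterlim_at_top_imp_at_infinity filterlim_tendsto_pos_mult_at_top[OF tendsto_const _ ln_d]) simp
    then show "(\<lambda>n. min_power \<alpha> n (d n) m (h n) (P0 n) B) \<longlonglongrightarrow> 1"
      using lower upper by (intro tendsto_sandwich[OF lower _ _ tendsto_const]) auto
  qed
qed

end
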